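(* Let $(\mathscr{C},\mathbb{E},\mathfrak{s})$ be an $n$-exangulated category. For any special precovering ideal $\mathfrak{I}$ of $\mathscr{C}$, $\mathfrak{I}$ equals the ideal $\mathbf{Ph}(\mathbf{PB}(\mathfrak{I}))$ of $n$-$\mathbf{PB}(\mathfrak{I})$-phantom morphisms.
   Context: **$n$-exangulated categories.** Let $n\ge 1$, let $\mathscr{C}$ be an additive category and $\mathbb{E}:\mathscr{C}^{op}\times\mathscr{C}\to\mathsf{Ab}$ a biadditive functor. An element $\delta\in\mathbb{E}(C,A)$ is called an extension; for $a:A\to A'$ and $c:C'\to C$ write $a_*\delta=\mathbb{E}(C,a)(\delta)$ and $c^*\delta=\mathbb{E}(c,A)(\delta)$. A morphism of extensions $(a,c):\delta\to\delta'$ (with $\delta\in\mathbb{E}(C,A)$, $\delta'\in\mathbb{E}(C',A')$) is a pair $a:A\to A'$, $c:C\to C'$ with $a_*\delta=c^*\delta'$. Consider complexes $X^\bullet: X_0\xrightarrow{d_X^0}X_1\to\cdots\to X_n\xrightarrow{d_X^n}X_{n+1}$ in $\mathscr{C}$. A pair $\langle X^\bullet,\delta\rangle$ with $\delta\in\mathbb{E}(X_{n+1},X_0)$ is an $n$-exangle if for every object $W$ the sequences $\mathscr{C}(W,X_0)\to\cdots\to\mathscr{C}(W,X_{n+1})\to\mathbb{E}(W,X_0)$ (last map $f\mapsto f^*\delta$) and $\mathscr{C}(X_{n+1},W)\to\cdots\to\mathscr{C}(X_0,W)\to\mathbb{E}(X_{n+1},W)$ (last map $g\mapsto g_*\delta$)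 are exact. A morphism of $n$-exangles $\langle X^\bullet,\delta\rangle\to\langle Y^\bullet,\rho\rangle$ is a chain map $f^\bullet=(f^0,\dots,f^{n+1})$ with $(f^0)_*\delta=(f^{n+1})^*\rho$. For fixed ends $X_0=A$, $X_{n+1}=C$, one considers chain maps that are identities at both ends; two such $f,g:X^\bullet\to Y^\bullet$ are homotopic if there are $\varphi^i:X_i\to Y_{i-1}$ ($1\le i\le n+1$) with $\varphi^1d_X^0=0$, $g^i-f^i=d_Y^{i-1}\varphi^i+\varphi^{i+1}d_X^i$ ($1\le i\le n$), $d_Y^n\varphi^{n+1}=0$; this gives homotopy equivalence classes $[X^\bullet]$. An exact realization $\mathfrak{s}$ assigns to each $\delta\in\mathbb{E}(C,A)$ such a class $\mathfrak{s}(\delta)=[X^\bullet]$ with ends $A,C$, such that: (R0) if $\mathfrak{s}(\delta)=[X^\bullet]$, $\mathfrak{s}(\rho)=[Y^\bullet]$, every morphism of extensions $(a,c):\delta\to\rho$ lifts to a chain map $(a,f^1,\dots,f^n,c):X^\bullet\to Y^\bullet$; (R1) if $\mathfrak{s}(\delta)=[X^\bullet]$ then $\langle X^\bullet,\delta\rangle$ is an $n$-exangle; (R2) $\mathfrak{s}$ sends $0\in\mathbb{E}(0,A)$ to $[A\xrightarrow{1}A\to0\to\cdots\to0]$ and $0\in\mathbb{E}(A,0)$ to $[0\to\cdots\to0\to A\xrightarrow{1}A]$. If $\mathfrak{s}(\delta)=[X^\bullet]$, then $\langle X^\bullet,\delta\rangle$ is called a distinguished $n$-exangle, $X^\bullet$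 is said to realize $\delta$, $d_X^0$ is called an inflation and $d_X^n$ a deflation. $(\mathscr{C},\mathbb{E},\mathfrak{s})$ is an $n$-exangulated category if $\mathfrak{s}$ is an exact realization and: (EA1) inflations are closed under composition, and so are deflations; (EA2) for $\rho\in\mathbb{E}(D,A)$, $c:C\to D$ and distinguished $\langle X^\bullet,c^*\rho\rangle$, $\langle Y^\bullet,\rho\rangle$, the morphism $(1_A,c)$ has a lift $f^\bullet$ whose mapping cone $X_1\to X_2\oplus Y_1\to\cdots\to X_{n+1}\oplus Y_n\to Y_{n+1}$ (differentials $\begin{bmatrix}-d_X^1\\ f^1\end{bmatrix}$, $\begin{bmatrix}-d_X^{i+1}&0\\ f^{i+1}&d_Y^i\end{bmatrix}$, $\begin{bmatrix}f^{n+1}&d_Y^n\end{bmatrix}$) together with $(d_X^0)_*\rho$ is a distinguished $n$-exangle; (EA2$^{op}$) the dual of (EA2). **Ideals.** An ideal $\mathfrak{I}$ of $\mathscr{C}$ is a two-sided ideal of morphisms (subgroups $\mathfrak{I}(A,B)\subseteq\mathscr{C}(A,B)$ closed under composition with arbitrary morphisms on both sides). For $m:X\to C$, $g:A\to B$, $\mathbb{E}(m,g):\mathbb{E}(C,A)\to\mathbb{E}(X,B)$ is $\delta\mapsto g_*m^*\delta$, and $\mathfrak{I}^\perp=\{g:\mathbb{E}(m,g)=0\ \forall m\in\mathfrak{I}\}$. A morphism $i:Y_n\to C$ in $\mathfrak{I}$ is a special $\mathfrak{I}$-precover of $C$ if there are $\delta\in\mathbb{E}(C,A)$ and $j:A\to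 A'$ in $\mathfrak{I}^\perp$ and a distinguished $n$-exangle $\langle Y^\bullet,j_*\delta\rangle$ (ends $A',C$) with $d_Y^n=i$; $\mathfrak{I}$ is special precovering if every object has a special $\mathfrak{I}$-precover. **Subfunctors and phantoms.** An additive subfunctor $\mathbb{F}\subseteq\mathbb{E}$ consists of subgroups $\mathbb{F}(C,A)\subseteq\mathbb{E}(C,A)$ stable under all $a_*$ and $c^*$. $\mathbf{Ph}(\mathbb{F})$ is the ideal of all $\phi:X\to C$ such that $\phi^*\delta\in\mathbb{F}(X,A)$ for all $A$ and all $\delta\in\mathbb{E}(C,A)$ ($n$-$\mathbb{F}$-phantom morphisms). $\mathbf{PB}(\mathfrak{I})$ is the additive subfunctor with $\mathbf{PB}(\mathfrak{I})(X,A)=\{f^*\delta: f\in\mathfrak{I}(X,C),\ \delta\in\mathbb{E}(C,A),\ C\in\mathscr{C}\}$. *)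

theory Defs
  imports "HOL-Algebra.Coset"
begin

section \<open>Additive categories and biadditive functors\<close>

text \<open>
  The hom-sets \<open>Hom C A B\<close> and the sets of extensions \<open>Ext C Z A\<close> are abelian groups. They are
  represented by HOL-Algebra group records, so addition, zero and negation are
  written \<open>\<otimes>\<close>, \<open>\<one>\<close> and \<open>inv\<close>.
  Composition is in the usual order: \<open>g \<cdot> f\<close> is ``first \<open>f\<close>, then \<open>g\<close>''.
\<close>

record ('o, 'm) category =
  Obj :: "'o set"
  Hom :: "'o \<Rightarrow> 'o \<Rightarrow> 'm monoid"
  Id :: "'o \<Rightarrow> 'm"
  Comp :: "'m \<Rightarrow> 'm \<Rightarrow> 'm"  (infixr "\<cdot>\<index>" 75)

text \<open>
  \<open>Ext C Z A\<close> is the group \<open>E(Z, A)\<close>, and for \<open>c : Z' \<rightarrow> Z\<close> and \<open>a : A \<rightarrow> A'\<close> the map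
  \<open>Emap C c a\<close> is \<open>E(c, a) : E(Z, A) \<rightarrow> E(Z', A')\<close>.
\<close>

record ('o, 'm, 'e) ext_category = "('o, 'm) category" +
  Ext :: "'o \<Rightarrow> 'o \<Rightarrow> 'e monoid"
  Emap :: "'m \<Rightarrow> 'm \<Rightarrow> 'e \<Rightarrow> 'e"

abbreviation hom_set :: "('o, 'm, 'z) category_scheme \<Rightarrow> 'o \<Rightarrow> 'o \<Rightarrow> 'm set" where
  "hom_set C A B \<equiv> carrier (Hom C A B)"

abbreviation zero_mor :: "('o, 'm, 'z) category_scheme \<Rightarrow> 'o \<Rightarrow> 'o \<Rightarrow> 'm" where
  "zero_mor C A B \<equiv> \<one>\<^bsub>Hom C A B\<^esub>"

abbreviation neg_mor :: "('o, 'm, 'z) category_scheme \<Rightarrow> 'o \<Rightarrow> 'o \<Rightarrow> 'm \<Rightarrow> 'm" where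
  "neg_mor C A B f \<equiv> inv\<^bsub>Hom C A B\<^esub> f"

abbreviation ext_set :: "('o, 'm, 'e, 'z) ext_category_scheme \<Rightarrow> 'o \<Rightarrow> 'o \<Rightarrow> 'e set" where
  "ext_set C Z A \<equiv> carrier (Ext C Z A)"

abbreviation zero_ext :: "('o, 'm, 'e, 'z) ext_category_scheme \<Rightarrow> 'o \<Rightarrow> 'o \<Rightarrow> 'e" where
  "zero_ext C Z A \<equiv> \<one>\<^bsub>Ext C Z A\<^esub>"

definition is_zero_object :: "('o, 'm, 'z) category_scheme \<Rightarrow> 'o \<Rightarrow> bool" where
  "is_zero_object C Z \<longleftrightarrow> Z \<in> Obj C \<and>
     (\<forall>A\<in>Obj C. (\<exists>!f. f \<in> hom_set C A Z) \<and> (\<exists>!f. f \<in> hom_set C Z A))"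

definition is_biproduct ::
  "('o, 'm, 'z) category_scheme \<Rightarrow> 'o \<Rightarrow> 'o \<Rightarrow> 'o \<times> 'm \<times> 'm \<times> 'm \<times> 'm \<Rightarrow> bool" where
  "is_biproduct C A B = (\<lambda>(P, i\<^sub>1, i\<^sub>2, p\<^sub>1, p\<^sub>2).
     P \<in> Obj C \<and> i\<^sub>1 \<in> hom_set C A P \<and> i\<^sub>2 \<in> hom_set C B P \<and>
     p\<^sub>1 \<in> hom_set C P A \<and> p\<^sub>2 \<in> hom_set C P B \<and>
     p\<^sub>1 \<cdot>\<^bsub>C\<^esub> i\<^sub>1 = Id C A \<and> p\<^sub>2 \<cdot>\<^bsub>C\<^esub> i\<^sub>2 = Id C B \<and>
     p\<^sub>1 \<cdot>\<^bsub>C\<^esub> i\<^sub>2 = zero_mor C B A \<and> p\<^sub>2 \<cdot>\<^bsub>C\<^esub> i\<^sub>1 = zero_mor C A B \<and>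
     (i\<^sub>1 \<cdot>\<^bsub>C\<^esub> p\<^sub>1) \<otimes>\<^bsub>Hom C P P\<^esub> (i\<^sub>2 \<cdot>\<^bsub>C\<^esub> p\<^sub>2) = Id C P)"

text \<open>
  Composition does not mention the objects involved, so a morphism must determine its domain and
  codomain; this is the axiom \<open>hom_disjoint\<close>.
\<close>

locale additive_category =
  fixes C :: "('o, 'm, 'z) category_scheme" (structure)
  assumes hom_disjoint: "\<lbrakk>A \<in> Obj C; B \<in> Obj C; A' \<in> Obj C; B' \<in> Obj C;
      f \<in> hom_set C A B; f \<in> hom_set C A' B'\<rbrakk> \<Longrightarrow> A = A' \<and> B = B'"
    and id_hom: "A \<in> Obj C \<Longrightarrow> Id C A \<in> hom_set C A A"
    and comp_hom: "\<lbrakk>A \<in> Obj C; B \<in> Obj C; D \<in> Obj C; f \<in> hom_set C A B; g \<in> hom_set C B D\<rbrakk>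
      \<Longrightarrow> g \<cdot> f \<in> hom_set C A D"
    and comp_id_right: "\<lbrakk>A \<in> Obj C; B \<in> Obj C; f \<in> hom_set C A B\<rbrakk> \<Longrightarrow> f \<cdot> Id C A = f"
    and comp_id_left: "\<lbrakk>A \<in> Obj C; B \<in> Obj C; f \<in> hom_set C A B\<rbrakk> \<Longrightarrow> Id C B \<cdot> f = f"
    and comp_assoc: "\<lbrakk>A \<in> Obj C; B \<in> Obj C; D \<in> Obj C; D' \<in> Obj C;
      f \<in> hom_set C A B; g \<in> hom_set C B D; h \<in> hom_set C D D'\<rbrakk>
      \<Longrightarrow> (h \<cdot> g) \<cdot> f = h \<cdot> (g \<cdot> f)"
    and hom_group: "\<lbrakk>A \<in> Obj C; B \<in> Obj C\<rbrakk> \<Longrightarrow> comm_group (Hom C A B)"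
    and comp_add_right: "\<lbrakk>A \<in> Obj C; B \<in> Obj C; D \<in> Obj C;
      f \<in> hom_set C A B; f' \<in> hom_set C A B; g \<in> hom_set C B D\<rbrakk>
      \<Longrightarrow> g \<cdot> (f \<otimes>\<^bsub>Hom C A B\<^esub> f') = (g \<cdot> f) \<otimes>\<^bsub>Hom C A D\<^esub> (g \<cdot> f')"
    and comp_add_left: "\<lbrakk>A \<in> Obj C; B \<in> Obj C; D \<in> Obj C;
      f \<in> hom_set C A B; g \<in> hom_set C B D; g' \<in> hom_set C B D\<rbrakk>
      \<Longrightarrow> (g \<otimes>\<^bsub>Hom C B D\<^esub> g') \<cdot> f = (g \<cdot> f) \<otimes>\<^bsub>Hom C A D\<^esub> (g' \<cdot> f)"
    and zero_object: "\<exists>Z. is_zero_object C Z"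
    and biproduct: "\<lbrakk>A \<in> Obj C; B \<in> Obj C\<rbrakk> \<Longrightarrow> \<exists>b. is_biproduct C A B b"

text \<open>An additive category with a biadditive functor from \<open>C\<^sup>o\<^sup>p \<times> C\<close> to abelian groups.\<close>

locale biadditive_ext = additive_category C
  for C :: "('o, 'm, 'e, 'z) ext_category_scheme" (structure) +
  assumes ext_group: "\<lbrakk>Z \<in> Obj C; A \<in> Obj C\<rbrakk> \<Longrightarrow> comm_group (Ext C Z A)"
    and emap_hom: "\<lbrakk>Z \<in> Obj C; Z' \<in> Obj C; A \<in> Obj C; A' \<in> Obj C;
      c \<in> hom_set C Z' Z; a \<in> hom_set C A A'\<rbrakk>
      \<Longrightarrow> Emap C c a \<in> hom (Ext C Z A) (Ext C Z' A')"
    and emap_id: "\<lbrakk>Z \<in> Obj C; A \<in> Obj C; \<delta> \<in> ext_set C Z A\<rbrakk>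
      \<Longrightarrow> Emap C (Id C Z) (Id C A) \<delta> = \<delta>"
    and emap_comp: "\<lbrakk>Z \<in> Obj C; Z' \<in> Obj C; Z'' \<in> Obj C; A \<in> Obj C; A' \<in> Obj C; A'' \<in> Obj C;
      c \<in> hom_set C Z' Z; c' \<in> hom_set C Z'' Z'; a \<in> hom_set C A A'; a' \<in> hom_set C A' A'';
      \<delta> \<in> ext_set C Z A\<rbrakk>
      \<Longrightarrow> Emap C (c \<cdot> c') (a' \<cdot> a) \<delta> = Emap C c' a' (Emap C c a \<delta>)"
    and emap_add_left: "\<lbrakk>Z \<in> Obj C; Z' \<in> Obj C; A \<in> Obj C; A' \<in> Obj C;
      c \<in> hom_set C Z' Z; c' \<in> hom_set C Z' Z; a \<in> hom_set C A A'; \<delta> \<in> ext_set C Z A\<rbrakk>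
      \<Longrightarrow> Emap C (c \<otimes>\<^bsub>Hom C Z' Z\<^esub> c') a \<delta> = Emap C c a \<delta> \<otimes>\<^bsub>Ext C Z' A'\<^esub> Emap C c' a \<delta>"
    and emap_add_right: "\<lbrakk>Z \<in> Obj C; Z' \<in> Obj C; A \<in> Obj C; A' \<in> Obj C;
      c \<in> hom_set C Z' Z; a \<in> hom_set C A A'; a' \<in> hom_set C A A'; \<delta> \<in> ext_set C Z A\<rbrakk>
      \<Longrightarrow> Emap C c (a \<otimes>\<^bsub>Hom C A A'\<^esub> a') \<delta> = Emap C c a \<delta> \<otimes>\<^bsub>Ext C Z' A'\<^esub> Emap C c a' \<delta>"

text \<open>
  For \<open>\<delta> \<in> E(Z, A)\<close>, \<open>push C Z a \<delta>\<close> is \<open>a\<^sub>* \<delta>\<close> and \<open>pull C A c \<delta>\<close> is \<open>c\<^sup>* \<delta>\<close>. The object argument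
  is the end of \<open>\<delta>\<close> that stays fixed.
\<close>

definition push :: "('o, 'm, 'e, 'z) ext_category_scheme \<Rightarrow> 'o \<Rightarrow> 'm \<Rightarrow> 'e \<Rightarrow> 'e" where
  "push C Z a \<delta> = Emap C (Id C Z) a \<delta>"

definition pull :: "('o, 'm, 'e, 'z) ext_category_scheme \<Rightarrow> 'o \<Rightarrow> 'm \<Rightarrow> 'e \<Rightarrow> 'e" where
  "pull C A c \<delta> = Emap C c (Id C A) \<delta>"


section \<open>Direct sums and matrices of morphisms\<close>

text \<open>
  A biproduct of each pair of objects is chosen once and for all. Below, biproducts are used only to
  form mapping cones; another choice gives isomorphic complexes with the same ends, hence the
  same homotopy equivalence classes.
\<close>

definition biprod :: "('o, 'm, 'z) category_scheme \<Rightarrow> 'o \<Rightarrow> 'o \<Rightarrow> 'o \<times> 'm \<times> 'm \<times> 'm \<times> 'm" where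
  "biprod C A B = (SOME b. is_biproduct C A B b)"

definition dsum :: "('o, 'm, 'z) category_scheme \<Rightarrow> 'o \<Rightarrow> 'o \<Rightarrow> 'o" where
  "dsum C A B = (case biprod C A B of (P, i\<^sub>1, i\<^sub>2, p\<^sub>1, p\<^sub>2) \<Rightarrow> P)"

text \<open>\<open>col C W A B f g\<close> is the column \<open>[f; g] : W \<rightarrow> A \<oplus> B\<close>.\<close>

definition col :: "('o, 'm, 'z) category_scheme \<Rightarrow> 'o \<Rightarrow> 'o \<Rightarrow> 'o \<Rightarrow> 'm \<Rightarrow> 'm \<Rightarrow> 'm" where
  "col C W A B f g = (case biprod C A B of (P, i\<^sub>1, i\<^sub>2, p\<^sub>1, p\<^sub>2) \<Rightarrow>
     (i\<^sub>1 \<cdot>\<^bsub>C\<^esub> f) \<otimes>\<^bsub>Hom C W P\<^esub> (i\<^sub>2 \<cdot>\<^bsub>C\<^esub> g))"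

text \<open>\<open>row C A B W f g\<close> is the row \<open>[f g] : A \<oplus> B \<rightarrow> W\<close>.\<close>

definition row :: "('o, 'm, 'z) category_scheme \<Rightarrow> 'o \<Rightarrow> 'o \<Rightarrow> 'o \<Rightarrow> 'm \<Rightarrow> 'm \<Rightarrow> 'm" where
  "row C A B W f g = (case biprod C A B of (P, i\<^sub>1, i\<^sub>2, p\<^sub>1, p\<^sub>2) \<Rightarrow>
     (f \<cdot>\<^bsub>C\<^esub> p\<^sub>1) \<otimes>\<^bsub>Hom C P W\<^esub> (g \<cdot>\<^bsub>C\<^esub> p\<^sub>2))"

text \<open>\<open>mat22 C A B A' B' a b c d\<close> is the matrix \<open>[a b; c d] : A \<oplus> B \<rightarrow> A' \<oplus> B'\<close>.\<close>

definition mat22 :: "('o, 'm, 'z) category_scheme \<Rightarrow> 'o \<Rightarrow> 'o \<Rightarrow> 'o \<Rightarrow> 'o \<Rightarrow>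
    'm \<Rightarrow> 'm \<Rightarrow> 'm \<Rightarrow> 'm \<Rightarrow> 'm" where
  "mat22 C A B A' B' a b c d =
     col C (dsum C A B) A' B' (row C A B A' a b) (row C A B B' c d)"


section \<open>Complexes and homotopy\<close>

text \<open>
  A complex \<open>X\<^sub>0 \<rightarrow> \<dots> \<rightarrow> X\<^sub>n\<^sub>+\<^sub>1\<close> is given by the objects \<open>ob X i\<close> for \<open>i \<le> n + 1\<close> and the differentials
  \<open>dif X i : X\<^sub>i \<rightarrow> X\<^sub>i\<^sub>+\<^sub>1\<close> for \<open>i \<le> n\<close>. Values at larger indices are irrelevant and never inspected;
  the same convention applies to chain maps and homotopies.
\<close>

record ('o, 'm) complex =
  ob :: "nat \<Rightarrow> 'o"
  dif :: "nat \<Rightarrow> 'm"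

definition is_complex :: "nat \<Rightarrow> ('o, 'm, 'z) category_scheme \<Rightarrow> ('o, 'm) complex \<Rightarrow> bool" where
  "is_complex n C X \<longleftrightarrow>
     (\<forall>i\<le>n+1. ob X i \<in> Obj C) \<and>
     (\<forall>i\<le>n. dif X i \<in> hom_set C (ob X i) (ob X (i+1))) \<and>
     (\<forall>i<n. dif X (i+1) \<cdot>\<^bsub>C\<^esub> dif X i = zero_mor C (ob X i) (ob X (i+2)))"

definition chain_map :: "nat \<Rightarrow> ('o, 'm, 'z) category_scheme \<Rightarrow>
    ('o, 'm) complex \<Rightarrow> ('o, 'm) complex \<Rightarrow> (nat \<Rightarrow> 'm) \<Rightarrow> bool" where
  "chain_map n C X Y f \<longleftrightarrow>
     (\<forall>i\<le>n+1. f i \<in> hom_set C (ob X i) (ob Y i)) \<and>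
     (\<forall>i\<le>n. f (i+1) \<cdot>\<^bsub>C\<^esub> dif X i = dif Y i \<cdot>\<^bsub>C\<^esub> f i)"

text \<open>Chain maps that are the identity at both ends.\<close>

definition end_fixing :: "nat \<Rightarrow> ('o, 'm, 'z) category_scheme \<Rightarrow>
    ('o, 'm) complex \<Rightarrow> ('o, 'm) complex \<Rightarrow> (nat \<Rightarrow> 'm) \<Rightarrow> bool" where
  "end_fixing n C X Y f \<longleftrightarrow> chain_map n C X Y f \<and>
     ob X 0 = ob Y 0 \<and> ob X (n+1) = ob Y (n+1) \<and>
     f 0 = Id C (ob X 0) \<and> f (n+1) = Id C (ob X (n+1))"

definition homotopic :: "nat \<Rightarrow> ('o, 'm, 'z) category_scheme \<Rightarrow>
    ('o, 'm) complex \<Rightarrow> ('o, 'm) complex \<Rightarrow> (nat \<Rightarrow> 'm) \<Rightarrow> (nat \<Rightarrow> 'm) \<Rightarrow> bool" where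
  "homotopic n C X Y f g \<longleftrightarrow> (\<exists>\<phi>.
     (\<forall>i\<in>{1..n+1}. \<phi> i \<in> hom_set C (ob X i) (ob Y (i-1))) \<and>
     \<phi> 1 \<cdot>\<^bsub>C\<^esub> dif X 0 = zero_mor C (ob X 0) (ob Y 0) \<and>
     (\<forall>i\<in>{1..n}. g i \<otimes>\<^bsub>Hom C (ob X i) (ob Y i)\<^esub> neg_mor C (ob X i) (ob Y i) (f i) =
        (dif Y (i-1) \<cdot>\<^bsub>C\<^esub> \<phi> i) \<otimes>\<^bsub>Hom C (ob X i) (ob Y i)\<^esub> (\<phi> (i+1) \<cdot>\<^bsub>C\<^esub> dif X i)) \<and>
     dif Y n \<cdot>\<^bsub>C\<^esub> \<phi> (n+1) = zero_mor C (ob X (n+1)) (ob Y (n+1)))"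

definition homotopy_equivalent :: "nat \<Rightarrow> ('o, 'm, 'z) category_scheme \<Rightarrow>
    ('o, 'm) complex \<Rightarrow> ('o, 'm) complex \<Rightarrow> bool" where
  "homotopy_equivalent n C X Y \<longleftrightarrow> (\<exists>f g.
     end_fixing n C X Y f \<and> end_fixing n C Y X g \<and>
     homotopic n C X X (\<lambda>i. g i \<cdot>\<^bsub>C\<^esub> f i) (\<lambda>i. Id C (ob X i)) \<and>
     homotopic n C Y Y (\<lambda>i. f i \<cdot>\<^bsub>C\<^esub> g i) (\<lambda>i. Id C (ob Y i)))"

definition homotopy_class :: "nat \<Rightarrow> ('o, 'm, 'z) category_scheme \<Rightarrow>
    ('o, 'm) complex \<Rightarrow> ('o, 'm) complex set" where
  "homotopy_class n C X = {Y. is_complex n C Y \<and> homotopy_equivalent n C X Y}"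


section \<open>Exangles and realizations\<close>

definition exact_at :: "('a, 'x) monoid_scheme \<Rightarrow> ('a \<Rightarrow> 'b) \<Rightarrow> ('b, 'y) monoid_scheme \<Rightarrow>
    ('b \<Rightarrow> 'c) \<Rightarrow> ('c, 'w) monoid_scheme \<Rightarrow> bool" where
  "exact_at G f H g K \<longleftrightarrow> f ` carrier G = kernel H K g"

definition is_exangle :: "nat \<Rightarrow> ('o, 'm, 'e, 'z) ext_category_scheme \<Rightarrow>
    ('o, 'm) complex \<Rightarrow> 'e \<Rightarrow> bool" where
  "is_exangle n C X \<delta> \<longleftrightarrow> is_complex n C X \<and> \<delta> \<in> ext_set C (ob X (n+1)) (ob X 0) \<and>
     (\<forall>W\<in>Obj C.
        (\<forall>i<n. exact_at (Hom C W (ob X i)) (\<lambda>f. dif X i \<cdot>\<^bsub>C\<^esub> f)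
                 (Hom C W (ob X (i+1))) (\<lambda>f. dif X (i+1) \<cdot>\<^bsub>C\<^esub> f) (Hom C W (ob X (i+2)))) \<and>
        exact_at (Hom C W (ob X n)) (\<lambda>f. dif X n \<cdot>\<^bsub>C\<^esub> f)
          (Hom C W (ob X (n+1))) (\<lambda>f. pull C (ob X 0) f \<delta>) (Ext C W (ob X 0)) \<and>
        (\<forall>i<n. exact_at (Hom C (ob X (i+2)) W) (\<lambda>g. g \<cdot>\<^bsub>C\<^esub> dif X (i+1))
                 (Hom C (ob X (i+1)) W) (\<lambda>g. g \<cdot>\<^bsub>C\<^esub> dif X i) (Hom C (ob X i) W)) \<and>
        exact_at (Hom C (ob X 1) W) (\<lambda>g. g \<cdot>\<^bsub>C\<^esub> dif X 0)
          (Hom C (ob X 0) W) (\<lambda>g. push C (ob X (n+1)) g \<delta>) (Ext C (ob X (n+1)) W))"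

text \<open>
  A realization is a function \<open>s\<close> sending \<open>Z\<close>, \<open>A\<close> and \<open>\<delta> \<in> E(Z, A)\<close> to a homotopy equivalence class of
  complexes from \<open>A\<close> to \<open>Z\<close>.
\<close>

type_synonym ('o, 'm, 'e) realization = "'o \<Rightarrow> 'o \<Rightarrow> 'e \<Rightarrow> ('o, 'm) complex set"

definition distinguished :: "nat \<Rightarrow> ('o, 'm, 'e, 'z) ext_category_scheme \<Rightarrow>
    ('o, 'm, 'e) realization \<Rightarrow> ('o, 'm) complex \<Rightarrow> 'e \<Rightarrow> bool" where
  "distinguished n C s X \<delta> \<longleftrightarrow> is_complex n C X \<and> \<delta> \<in> ext_set C (ob X (n+1)) (ob X 0) \<and>
     s (ob X (n+1)) (ob X 0) \<delta> = homotopy_class n C X"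

text \<open>The complexes \<open>A = A \<rightarrow> 0 \<rightarrow> \<dots> \<rightarrow> 0\<close> and \<open>0 \<rightarrow> \<dots> \<rightarrow> 0 \<rightarrow> A = A\<close>, where \<open>Z\<close> is a zero object.\<close>

definition split_left :: "('o, 'm, 'z) category_scheme \<Rightarrow> 'o \<Rightarrow> 'o \<Rightarrow> ('o, 'm) complex" where
  "split_left C Z A =
     \<lparr>ob = (\<lambda>i. if i \<le> 1 then A else Z),
      dif = (\<lambda>i. if i = 0 then Id C A else if i = 1 then zero_mor C A Z else zero_mor C Z Z)\<rparr>"

definition split_right :: "nat \<Rightarrow> ('o, 'm, 'z) category_scheme \<Rightarrow> 'o \<Rightarrow> 'o \<Rightarrow> ('o, 'm) complex" where
  "split_right n C Z A =
     \<lparr>ob = (\<lambda>i. if i < n then Z else A),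
      dif = (\<lambda>i. if i = n then Id C A else if i + 1 = n then zero_mor C Z A else zero_mor C Z Z)\<rparr>"

definition exact_realization :: "nat \<Rightarrow> ('o, 'm, 'e, 'z) ext_category_scheme \<Rightarrow>
    ('o, 'm, 'e) realization \<Rightarrow> bool" where
  "exact_realization n C s \<longleftrightarrow>
     \<comment> \<open>every value is a homotopy equivalence class\<close>
     (\<forall>Z\<in>Obj C. \<forall>A\<in>Obj C. \<forall>\<delta>\<in>ext_set C Z A.
        \<exists>X. is_complex n C X \<and> ob X 0 = A \<and> ob X (n+1) = Z \<and> s Z A \<delta> = homotopy_class n C X) \<and>
     \<comment> \<open>(R0)\<close>
     (\<forall>X Y \<delta> \<rho> a c. distinguished n C s X \<delta> \<and> distinguished n C s Y \<rho> \<and>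
        a \<in> hom_set C (ob X 0) (ob Y 0) \<and> c \<in> hom_set C (ob X (n+1)) (ob Y (n+1)) \<and>
        push C (ob X (n+1)) a \<delta> = pull C (ob Y 0) c \<rho> \<longrightarrow>
        (\<exists>f. chain_map n C X Y f \<and> f 0 = a \<and> f (n+1) = c)) \<and>
     \<comment> \<open>(R1)\<close>
     (\<forall>X \<delta>. distinguished n C s X \<delta> \<longrightarrow> is_exangle n C X \<delta>) \<and>
     \<comment> \<open>(R2)\<close>
     (\<forall>Z A. is_zero_object C Z \<and> A \<in> Obj C \<longrightarrow>
        s Z A (zero_ext C Z A) = homotopy_class n C (split_left C Z A) \<and>
        s A Z (zero_ext C A Z) = homotopy_class n C (split_right n C Z A))"

definition inflation :: "nat \<Rightarrow> ('o, 'm, 'e, 'z) ext_category_scheme \<Rightarrow>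
    ('o, 'm, 'e) realization \<Rightarrow> 'm \<Rightarrow> bool" where
  "inflation n C s f \<longleftrightarrow> (\<exists>X \<delta>. distinguished n C s X \<delta> \<and> dif X 0 = f)"

definition deflation :: "nat \<Rightarrow> ('o, 'm, 'e, 'z) ext_category_scheme \<Rightarrow>
    ('o, 'm, 'e) realization \<Rightarrow> 'm \<Rightarrow> bool" where
  "deflation n C s f \<longleftrightarrow> (\<exists>X \<delta>. distinguished n C s X \<delta> \<and> dif X n = f)"

definition mapping_cone :: "nat \<Rightarrow> ('o, 'm, 'z) category_scheme \<Rightarrow>
    ('o, 'm) complex \<Rightarrow> ('o, 'm) complex \<Rightarrow> (nat \<Rightarrow> 'm) \<Rightarrow> ('o, 'm) complex" where
  "mapping_cone n C X Y f =
     \<lparr>ob = (\<lambda>i. if i = 0 then ob X 1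
                else if i \<le> n then dsum C (ob X (i+1)) (ob Y i)
                else ob Y (n+1)),
      dif = (\<lambda>i. if i = 0 then
                   col C (ob X 1) (ob X 2) (ob Y 1) (neg_mor C (ob X 1) (ob X 2) (dif X 1)) (f 1)
                 else if i < n then
                   mat22 C (ob X (i+1)) (ob Y i) (ob X (i+2)) (ob Y (i+1))
                     (neg_mor C (ob X (i+1)) (ob X (i+2)) (dif X (i+1)))
                     (zero_mor C (ob Y i) (ob X (i+2)))
                     (f (i+1)) (dif Y i)
                 else row C (ob X (n+1)) (ob Y n) (ob Y (n+1)) (f (n+1)) (dif Y n))\<rparr>"

text \<open>
  The mapping cocone is the mapping cone of \<open>f : Y \<rightarrow> X\<close> formed in the opposite category, read
  backwards: \<open>X\<^sub>0 \<rightarrow> Y\<^sub>0 \<oplus> X\<^sub>1 \<rightarrow> \<dots> \<rightarrow> Y\<^sub>n\<^sub>-\<^sub>1 \<oplus> X\<^sub>n \<rightarrow> Y\<^sub>n\<close>. Reversing arrows transposes the matrices, so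
  the signs fall on the differentials of \<open>Y\<close>.
\<close>

definition mapping_cocone :: "nat \<Rightarrow> ('o, 'm, 'z) category_scheme \<Rightarrow>
    ('o, 'm) complex \<Rightarrow> ('o, 'm) complex \<Rightarrow> (nat \<Rightarrow> 'm) \<Rightarrow> ('o, 'm) complex" where
  "mapping_cocone n C X Y f =
     \<lparr>ob = (\<lambda>i. if i = 0 then ob X 0
                else if i \<le> n then dsum C (ob Y (i-1)) (ob X i)
                else ob Y n),
      dif = (\<lambda>i. if i = 0 then col C (ob X 0) (ob Y 0) (ob X 1) (f 0) (dif X 0)
                 else if i < n then
                   mat22 C (ob Y (i-1)) (ob X i) (ob Y i) (ob X (i+1))
                     (neg_mor C (ob Y (i-1)) (ob Y i) (dif Y (i-1))) (f i)
                     (zero_mor C (ob Y (i-1)) (ob X (i+1))) (dif X i)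
                 else row C (ob Y (n-1)) (ob X n) (ob Y n)
                        (neg_mor C (ob Y (n-1)) (ob Y n) (dif Y (n-1))) (f n))\<rparr>"

locale n_exangulated_category = biadditive_ext C
  for n :: nat and C :: "('o, 'm, 'e, 'z) ext_category_scheme" (structure)
    and s :: "('o, 'm, 'e) realization" +
  assumes n_pos: "n \<ge> 1"
    and realization: "exact_realization n C s"
    and EA1_inflation: "\<lbrakk>A \<in> Obj C; B \<in> Obj C; D \<in> Obj C; f \<in> hom_set C A B; g \<in> hom_set C B D;
      inflation n C s f; inflation n C s g\<rbrakk> \<Longrightarrow> inflation n C s (g \<cdot> f)"
    and EA1_deflation: "\<lbrakk>A \<in> Obj C; B \<in> Obj C; D \<in> Obj C; f \<in> hom_set C A B; g \<in> hom_set C B D;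
      deflation n C s f; deflation n C s g\<rbrakk> \<Longrightarrow> deflation n C s (g \<cdot> f)"
    and EA2: "\<lbrakk>distinguished n C s Y \<rho>; ob X 0 = ob Y 0;
      c \<in> hom_set C (ob X (n+1)) (ob Y (n+1)); distinguished n C s X (pull C (ob Y 0) c \<rho>)\<rbrakk>
      \<Longrightarrow> \<exists>f. chain_map n C X Y f \<and> f 0 = Id C (ob X 0) \<and> f (n+1) = c \<and>
            distinguished n C s (mapping_cone n C X Y f) (push C (ob Y (n+1)) (dif X 0) \<rho>)"
    and EA2_op: "\<lbrakk>distinguished n C s X \<rho>; ob X (n+1) = ob Y (n+1);
      a \<in> hom_set C (ob X 0) (ob Y 0); distinguished n C s Y (push C (ob X (n+1)) a \<rho>)\<rbrakk>
      \<Longrightarrow> \<exists>f. chain_map n C X Y f \<and> f 0 = a \<and> f (n+1) = Id C (ob X (n+1)) \<and>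
            distinguished n C s (mapping_cocone n C X Y f) (pull C (ob X 0) (dif Y n) \<rho>)"


section \<open>Ideals, subfunctors and phantom morphisms\<close>

text \<open>An ideal is a set \<open>I\<close> of morphisms; \<open>I(A, B)\<close> is \<open>I \<inter> hom_set C A B\<close>.\<close>

definition ideal_of :: "('o, 'm, 'z) category_scheme \<Rightarrow> 'm set \<Rightarrow> bool" where
  "ideal_of C I \<longleftrightarrow>
     I \<subseteq> (\<Union>A\<in>Obj C. \<Union>B\<in>Obj C. hom_set C A B) \<and>
     (\<forall>A\<in>Obj C. \<forall>B\<in>Obj C. subgroup (I \<inter> hom_set C A B) (Hom C A B)) \<and>
     (\<forall>A\<in>Obj C. \<forall>B\<in>Obj C. \<forall>D\<in>Obj C. \<forall>f\<in>hom_set C A B. \<forall>g\<in>hom_set C B D.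
        f \<in> I \<or> g \<in> I \<longrightarrow> g \<cdot>\<^bsub>C\<^esub> f \<in> I)"

definition perp :: "('o, 'm, 'e, 'z) ext_category_scheme \<Rightarrow> 'm set \<Rightarrow> 'm set" where
  "perp C I = {g. \<exists>A\<in>Obj C. \<exists>B\<in>Obj C. g \<in> hom_set C A B \<and>
     (\<forall>X\<in>Obj C. \<forall>Z\<in>Obj C. \<forall>m\<in>I \<inter> hom_set C X Z. \<forall>\<delta>\<in>ext_set C Z A.
        Emap C m g \<delta> = zero_ext C X B)}"

definition special_precover :: "nat \<Rightarrow> ('o, 'm, 'e, 'z) ext_category_scheme \<Rightarrow>
    ('o, 'm, 'e) realization \<Rightarrow> 'm set \<Rightarrow> 'o \<Rightarrow> 'm \<Rightarrow> bool" where
  "special_precover n C s I Z i \<longleftrightarrow> i \<in> I \<and>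
     (\<exists>A\<in>Obj C. \<exists>A'\<in>Obj C. \<exists>\<delta>\<in>ext_set C Z A. \<exists>j\<in>perp C I \<inter> hom_set C A A'. \<exists>Y.
        distinguished n C s Y (push C Z j \<delta>) \<and> ob Y 0 = A' \<and> ob Y (n+1) = Z \<and> dif Y n = i)"

definition special_precovering :: "nat \<Rightarrow> ('o, 'm, 'e, 'z) ext_category_scheme \<Rightarrow>
    ('o, 'm, 'e) realization \<Rightarrow> 'm set \<Rightarrow> bool" where
  "special_precovering n C s I \<longleftrightarrow> (\<forall>Z\<in>Obj C. \<exists>i. special_precover n C s I Z i)"

definition additive_subfunctor :: "('o, 'm, 'e, 'z) ext_category_scheme \<Rightarrow>
    ('o \<Rightarrow> 'o \<Rightarrow> 'e set) \<Rightarrow> bool" where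
  "additive_subfunctor C F \<longleftrightarrow>
     (\<forall>Z\<in>Obj C. \<forall>A\<in>Obj C. subgroup (F Z A) (Ext C Z A)) \<and>
     (\<forall>Z\<in>Obj C. \<forall>A\<in>Obj C. \<forall>A'\<in>Obj C. \<forall>a\<in>hom_set C A A'. \<forall>\<delta>\<in>F Z A. push C Z a \<delta> \<in> F Z A') \<and>
     (\<forall>Z\<in>Obj C. \<forall>Z'\<in>Obj C. \<forall>A\<in>Obj C. \<forall>c\<in>hom_set C Z' Z. \<forall>\<delta>\<in>F Z A. pull C A c \<delta> \<in> F Z' A)"

definition Ph :: "('o, 'm, 'e, 'z) ext_category_scheme \<Rightarrow> ('o \<Rightarrow> 'o \<Rightarrow> 'e set) \<Rightarrow> 'm set" where
  "Ph C F = {\<phi>. \<exists>X\<in>Obj C. \<exists>Z\<in>Obj C. \<phi> \<in> hom_set C X Z \<and>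
     (\<forall>A\<in>Obj C. \<forall>\<delta>\<in>ext_set C Z A. pull C A \<phi> \<delta> \<in> F X A)}"

definition PB :: "('o, 'm, 'e, 'z) ext_category_scheme \<Rightarrow> 'm set \<Rightarrow> 'o \<Rightarrow> 'o \<Rightarrow> 'e set" where
  "PB C I X A = {pull C A f \<delta> |f \<delta> Z. Z \<in> Obj C \<and> f \<in> I \<inter> hom_set C X Z \<and> \<delta> \<in> ext_set C Z A}"

text \<open>
  \<open>Ph C F\<close> is meant for additive subfunctors \<open>F\<close>. The rest of the theory shows that \<open>PB C I\<close> is one;
  closure under addition uses biproducts.
\<close>

context biadditive_ext begin

lemma pull_in: "\<lbrakk>Z \<in> Obj C; Z' \<in> Obj C; A \<in> Obj C; c \<in> hom_set C Z' Z; \<delta> \<in> ext_set C Z A\<rbrakk>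
  \<Longrightarrow> pull C A c \<delta> \<in> ext_set C Z' A"
  unfolding pull_def by (rule hom_in_carrier[OF emap_hom]) (simp_all add: id_hom)

lemma push_in: "\<lbrakk>Z \<in> Obj C; A' \<in> Obj C; A \<in> Obj C; a \<in> hom_set C A A'; \<delta> \<in> ext_set C Z A\<rbrakk>
  \<Longrightarrow> push C Z a \<delta> \<in> ext_set C Z A'"
  unfolding push_def by (rule hom_in_carrier[OF emap_hom]) (simp_all add: id_hom)

lemma pull_hom: "\<lbrakk>Z \<in> Obj C; Z' \<in> Obj C; A \<in> Obj C; c \<in> hom_set C Z' Z\<rbrakk>
  \<Longrightarrow> group_hom (Ext C Z A) (Ext C Z' A) (pull C A c)"
proof -
  assume a: "Z \<in> Obj C" "Z' \<in> Obj C" "A \<in> Obj C" "c \<in> hom_set C Z' Z"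
  have "pull C A c = Emap C c (Id C A)" by (rule ext) (simp add: pull_def)
  then have "pull C A c \<in> hom (Ext C Z A) (Ext C Z' A)" using emap_hom a id_hom by simp
  then show ?thesis using ext_group a
    by (simp add: comm_group_def group_hom_axioms_def group_hom_def)
qed

lemma pull_comp: "\<lbrakk>Z \<in> Obj C; Z' \<in> Obj C; Z'' \<in> Obj C; A \<in> Obj C; c \<in> hom_set C Z' Z;
   c' \<in> hom_set C Z'' Z'; \<delta> \<in> ext_set C Z A\<rbrakk>
  \<Longrightarrow> pull C A c' (pull C A c \<delta>) = pull C A (c \<cdot> c') \<delta>"
  unfolding pull_def 
  using emap_comp[of Z Z' Z'' A A A c c' "Id C A" "Id C A" \<delta>] id_hom comp_id_left[of A A "Id C A"] by simp

lemma push_pull: "\<lbrakk>Z \<in> Obj C; Z' \<in> Obj C; A \<in> Obj C; A' \<in> Obj C; c \<in> hom_set C Z' Z;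
   a \<in> hom_set C A A'; \<delta> \<in> ext_set C Z A\<rbrakk>
  \<Longrightarrow> push C Z' a (pull C A c \<delta>) = Emap C c a \<delta>"
  unfolding pull_def push_def
  using emap_comp[of Z Z' Z' A A A' c "Id C Z'" "Id C A" a \<delta>] id_hom 
  by (simp add: comp_id_right)

lemma pull_push: "\<lbrakk>Z \<in> Obj C; Z' \<in> Obj C; A \<in> Obj C; A' \<in> Obj C; c \<in> hom_set C Z' Z;
   a \<in> hom_set C A A'; \<delta> \<in> ext_set C Z A\<rbrakk>
  \<Longrightarrow> pull C A' c (push C Z a \<delta>) = Emap C c a \<delta>"
  unfolding pull_def push_def
  using emap_comp[of Z Z Z' A A' A' "Id C Z" c a "Id C A'" \<delta>] id_hom 
  by (simp add: comp_id_left)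

lemma zero_comp: "\<lbrakk>A \<in> Obj C; B \<in> Obj C; D \<in> Obj C; f \<in> hom_set C A B\<rbrakk>
  \<Longrightarrow> zero_mor C B D \<cdot> f = zero_mor C A D"
proof -
  assume a: "A \<in> Obj C" "B \<in> Obj C" "D \<in> Obj C" "f \<in> hom_set C A B"
  interpret BD: comm_group "Hom C B D" using hom_group a by auto
  interpret AD: comm_group "Hom C A D" using hom_group a by auto
  have c: "zero_mor C B D \<cdot> f \<in> hom_set C A D" using comp_hom a by auto
  have "(zero_mor C B D \<otimes>\<^bsub>Hom C B D\<^esub> zero_mor C B D) \<cdot> f
    = (zero_mor C B D \<cdot> f) \<otimes>\<^bsub>Hom C A D\<^esub> (zero_mor C B D \<cdot> f)"
    by (rule comp_add_left) (use a in auto)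
  then show ?thesis using c by (metis AD.r_cancel_one AD.one_closed BD.one_closed BD.r_one)
qed

lemma ideal_ofD: "\<lbrakk>ideal_of C I; A \<in> Obj C; B \<in> Obj C; D \<in> Obj C; f \<in> hom_set C A B;
  g \<in> hom_set C B D; f \<in> I \<or> g \<in> I\<rbrakk> \<Longrightarrow> g \<cdot> f \<in> I"
  unfolding ideal_of_def by blast

lemma PB_subgroup:
  assumes I: "ideal_of C I" and X: "X \<in> Obj C" and A: "A \<in> Obj C"
  shows "subgroup (PB C I X A) (Ext C X A)"
proof -
  interpret XA: comm_group "Ext C X A" using ext_group X A by auto
  have sg: "\<And>A B. A \<in> Obj C \<Longrightarrow> B \<in> Obj C \<Longrightarrow> subgroup (I \<inter> hom_set C A B) (Hom C A B)"
    using I unfolding ideal_of_def by blast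
  show ?thesis
  proof (rule XA.subgroupI)
    show "PB C I X A \<subseteq> ext_set C X A" unfolding PB_def using X A pull_in by auto
    have "zero_mor C X X \<in> I \<inter> hom_set C X X" using sg[OF X X] subgroup.one_closed by blast
    then show "PB C I X A \<noteq> {}" unfolding PB_def using X A XA.one_closed by blast
  next
    fix e assume "e \<in> PB C I X A"
    then obtain f \<delta> Z where h: "e = pull C A f \<delta>" "Z \<in> Obj C" "f \<in> I \<inter> hom_set C X Z" "\<delta> \<in> ext_set C Z A"
      unfolding PB_def by blast
    interpret ZA: comm_group "Ext C Z A" using ext_group h A by auto
    interpret P: group_hom "Ext C Z A" "Ext C X A" "pull C A f" using pull_hom h X A by auto
    show "inv\<^bsub>Ext C X A\<^esub> e \<in> PB C I X A" unfolding PB_def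
    proof (intro CollectI exI conjI)
      show "inv\<^bsub>Ext C X A\<^esub> e = pull C A f (inv\<^bsub>Ext C Z A\<^esub> \<delta>)" using h P.hom_inv by simp
    qed (use h in auto)
  next
    fix e e' assume "e \<in> PB C I X A" and "e' \<in> PB C I X A"
    then obtain f \<delta> Z f' \<delta>' Z' where h: "e = pull C A f \<delta>" "Z \<in> Obj C" "f \<in> I \<inter> hom_set C X Z" "\<delta> \<in> ext_set C Z A"
      and h': "e' = pull C A f' \<delta>'" "Z' \<in> Obj C" "f' \<in> I \<inter> hom_set C X Z'" "\<delta>' \<in> ext_set C Z' A"
      unfolding PB_def by fast
    obtain P i1 i2 p1 p2 where "is_biproduct C Z Z' (P,i1,i2,p1,p2)"
      using biproduct[OF h(2) h'(2)] by (metis prod_cases5)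
    then have P: "P \<in> Obj C" and i1: "i1 \<in> hom_set C Z P" and i2: "i2 \<in> hom_set C Z' P"
      and p1: "p1 \<in> hom_set C P Z" and p2: "p2 \<in> hom_set C P Z'"
      and p1i1: "p1 \<cdot> i1 = Id C Z" and p2i2: "p2 \<cdot> i2 = Id C Z'"
      and p1i2: "p1 \<cdot> i2 = zero_mor C Z' Z" and p2i1: "p2 \<cdot> i1 = zero_mor C Z Z'"
      by (simp_all only: is_biproduct_def prod.case)
    have f: "f \<in> hom_set C X Z" "f \<in> I" and f': "f' \<in> hom_set C X Z'" "f' \<in> I"
      using h(3) h'(3) by simp_all
    interpret PA: comm_group "Ext C P A" by (rule ext_group[OF P A])
    interpret XZ: comm_group "Hom C X Z" by (rule hom_group[OF X h(2)])
    interpret XZ': comm_group "Hom C X Z'" by (rule hom_group[OF X h'(2)])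
    let ?h = "(i1 \<cdot> f) \<otimes>\<^bsub>Hom C X P\<^esub> (i2 \<cdot> f')"
    let ?e = "pull C A p1 \<delta> \<otimes>\<^bsub>Ext C P A\<^esub> pull C A p2 \<delta>'"
    have i1f: "i1 \<cdot> f \<in> hom_set C X P" by (rule comp_hom[OF X h(2) P f(1) i1])
    have i2f: "i2 \<cdot> f' \<in> hom_set C X P" by (rule comp_hom[OF X h'(2) P f'(1) i2])
    have "i1 \<cdot> f \<in> I" by (rule ideal_ofD[OF I X h(2) P f(1) i1]) (simp add: f(2))
    moreover have "i2 \<cdot> f' \<in> I" by (rule ideal_ofD[OF I X h'(2) P f'(1) i2]) (simp add: f'(2))
    ultimately have hI: "?h \<in> I \<inter> hom_set C X P"
      by (intro subgroup.m_closed[OF sg[OF X P]]) (simp_all add: i1f i2f)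
    then have hX: "?h \<in> hom_set C X P" by simp
    interpret H: group_hom "Ext C P A" "Ext C X A" "pull C A ?h" by (rule pull_hom[OF P X A hX])
    have e1: "pull C A p1 \<delta> \<in> ext_set C P A" by (rule pull_in[OF h(2) P A p1 h(4)])
    have e2: "pull C A p2 \<delta>' \<in> ext_set C P A" by (rule pull_in[OF h'(2) P A p2 h'(4)])
    have "p1 \<cdot> ?h = (p1 \<cdot> (i1 \<cdot> f)) \<otimes>\<^bsub>Hom C X Z\<^esub> (p1 \<cdot> (i2 \<cdot> f'))"
      by (rule comp_add_right[OF X P h(2) i1f i2f p1])
    also have "\<dots> = (Id C Z \<cdot> f) \<otimes>\<^bsub>Hom C X Z\<^esub> (zero_mor C Z' Z \<cdot> f')"
      by (simp only: comp_assoc[OF X h(2) P h(2) f(1) i1 p1, symmetric]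
          comp_assoc[OF X h'(2) P h(2) f'(1) i2 p1, symmetric] p1i1 p1i2)
    also have "\<dots> = f"
      by (simp only: comp_id_left[OF X h(2) f(1)] zero_comp[OF X h'(2) h(2) f'(1)] XZ.r_one[OF f(1)])
    finally have 1: "p1 \<cdot> ?h = f" .
    have "p2 \<cdot> ?h = (p2 \<cdot> (i1 \<cdot> f)) \<otimes>\<^bsub>Hom C X Z'\<^esub> (p2 \<cdot> (i2 \<cdot> f'))"
      by (rule comp_add_right[OF X P h'(2) i1f i2f p2])
    also have "\<dots> = (zero_mor C Z Z' \<cdot> f) \<otimes>\<^bsub>Hom C X Z'\<^esub> (Id C Z' \<cdot> f')"
      by (simp only: comp_assoc[OF X h(2) P h'(2) f(1) i1 p2, symmetric]
          comp_assoc[OF X h'(2) P h'(2) f'(1) i2 p2, symmetric] p2i1 p2i2)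
    also have "\<dots> = f'"
      by (simp only: comp_id_left[OF X h'(2) f'(1)] zero_comp[OF X h(2) h'(2) f(1)] XZ'.l_one[OF f'(1)])
    finally have 2: "p2 \<cdot> ?h = f'" .
    have "e \<otimes>\<^bsub>Ext C X A\<^esub> e' = pull C A ?h ?e"
      by (simp only: H.hom_mult[OF e1 e2] pull_comp[OF h(2) P X A p1 hX h(4)]
          pull_comp[OF h'(2) P X A p2 hX h'(4)] 1 2 h(1) h'(1))
    with P hI PA.m_closed[OF e1 e2] show "e \<otimes>\<^bsub>Ext C X A\<^esub> e' \<in> PB C I X A"
      unfolding PB_def by blast
  qed
qed

lemma PB_subfunctor: assumes I: "ideal_of C I" shows "additive_subfunctor C (PB C I)"
  unfolding additive_subfunctor_def
proof (intro conjI ballI)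
  show "\<And>Z A. Z \<in> Obj C \<Longrightarrow> A \<in> Obj C \<Longrightarrow> subgroup (PB C I Z A) (Ext C Z A)" using PB_subgroup[OF I] .
next
  fix Z A A' a \<delta> assume a: "Z \<in> Obj C" "A \<in> Obj C" "A' \<in> Obj C" "a \<in> hom_set C A A'" "\<delta> \<in> PB C I Z A"
  then obtain f e D where h: "\<delta> = pull C A f e" "D \<in> Obj C" "f \<in> I \<inter> hom_set C Z D" "e \<in> ext_set C D A"
    unfolding PB_def by blast
  have "push C Z a \<delta> = pull C A' f (push C D a e)" using h a push_pull pull_push by simp
  then show "push C Z a \<delta> \<in> PB C I Z A'" unfolding PB_def using h a push_in by blast
next
  fix Z Z' A c \<delta> assume a: "Z \<in> Obj C" "Z' \<in> Obj C" "A \<in> Obj C" "c \<in> hom_set C Z' Z" "\<delta> \<in> PB C I Z A"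
  then obtain f e D where h: "\<delta> = pull C A f e" "D \<in> Obj C" "f \<in> I \<inter> hom_set C Z D" "e \<in> ext_set C D A"
    unfolding PB_def by blast
  have "pull C A c \<delta> = pull C A (f \<cdot> c) e" using h a pull_comp by simp
  moreover have "f \<cdot> c \<in> I \<inter> hom_set C Z' D" using I h a comp_hom unfolding ideal_of_def by auto
  ultimately show "pull C A c \<delta> \<in> PB C I Z' A" unfolding PB_def using h by blast
qed

end

end

theory Submission
  imports Defs
begin

text \<open>
  Let \<open>\<phi> : X \<rightarrow> Z\<close> be phantom and let \<open>i\<close> be a special precover of \<open>Z\<close>, given by \<open>\<delta>\<close> and \<open>j\<close>. Then
  \<open>\<phi>\<^sup>*\<delta> = f\<^sup>*\<epsilon>\<close> for some \<open>f\<close> in the ideal, so \<open>\<phi>\<^sup>*(j\<^sub>*\<delta>) = E(f, j)(\<epsilon>) = 0\<close>, and exactness of the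
  exangle realizing \<open>j\<^sub>*\<delta>\<close> makes \<open>\<phi>\<close> factor through \<open>i\<close>.
\<close>

text \<open>\<open>perp\<close> only asserts that some domain and codomain of \<open>g\<close>
  exist; since a morphism determines both, they must be the given \<open>A\<close> and
  \<open>B\<close>.\<close>

lemma perpD:
  assumes "additive_category C" "g \<in> perp C I" "g \<in> hom_set C A B" "A \<in> Obj C" "B \<in> Obj C"
    and "X \<in> Obj C" "Z \<in> Obj C" "m \<in> I" "m \<in> hom_set C X Z" "\<delta> \<in> ext_set C Z A"
  shows "Emap C m g \<delta> = zero_ext C X B"
proof -
  obtain A' B' where AB: "A' \<in> Obj C" "B' \<in> Obj C" "g \<in> hom_set C A' B'"
    and z: "\<forall>X\<in>Obj C. \<forall>Z\<in>Obj C. \<forall>m\<in>I \<inter> hom_set C X Z. \<forall>\<delta>\<in>ext_set C Z A'.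
      Emap C m g \<delta> = zero_ext C X B'"
    using assms(2) unfolding perp_def by blast
  have "A' = A \<and> B' = B"
    using additive_category.hom_disjoint[OF assms(1) AB(1,2) assms(4,5) AB(3) assms(3)] .
  then show ?thesis using z assms by blast
qed

text \<open>Any pullback along \<open>f\<close> lies in \<open>PB C I\<close> with \<open>f\<close>
  itself as the witness.\<close>

lemma ideal_subset_Ph_PB:
  assumes "ideal_of C I"
  shows "I \<subseteq> Ph C (PB C I)"
proof
  fix f assume f: "f \<in> I"
  with assms obtain X Z where "X \<in> Obj C" "Z \<in> Obj C" "f \<in> hom_set C X Z"
    unfolding ideal_of_def by blast
  with f show "f \<in> Ph C (PB C I)"
    unfolding Ph_def PB_def by blast
qed

text \<open>By (R1), the covariant sequence is exact at its last hom-group, so the kernel of pulling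
  back is the image of composition with \<open>dif Y n\<close>.\<close>

lemma (in n_exangulated_category) deflation_factor:
  assumes Y: "distinguished n C s Y \<delta>" and W: "W \<in> Obj C"
    and f: "f \<in> hom_set C W (ob Y (n+1))"
    and zero: "pull C (ob Y 0) f \<delta> = zero_ext C W (ob Y 0)"
  obtains g where "g \<in> hom_set C W (ob Y n)" "f = dif Y n \<cdot> g"
proof -
  have "is_exangle n C Y \<delta>"
    using realization Y unfolding exact_realization_def by blast
  then have "exact_at (Hom C W (ob Y n)) (\<lambda>f. dif Y n \<cdot> f)
      (Hom C W (ob Y (n+1))) (\<lambda>f. pull C (ob Y 0) f \<delta>) (Ext C W (ob Y 0))"
    using W unfolding is_exangle_def by blast
  moreover have "f \<in> kernel (Hom C W (ob Y (n+1))) (Ext C W (ob Y 0)) (\<lambda>f. pull C (ob Y 0) f \<delta>)"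
    using f zero by (simp add: kernel_def)
  ultimately show thesis
    using that unfolding exact_at_def by blast
qed

lemma (in n_exangulated_category) Ph_PB_subset_ideal:
  assumes I: "ideal_of C I" and pre: "special_precovering n C s I"
  shows "Ph C (PB C I) \<subseteq> I"
proof
  fix \<phi> assume "\<phi> \<in> Ph C (PB C I)"
  then obtain X Z where X: "X \<in> Obj C" and Z: "Z \<in> Obj C" and \<phi>: "\<phi> \<in> hom_set C X Z"
    and phantom: "\<forall>A\<in>Obj C. \<forall>\<delta>\<in>ext_set C Z A. pull C A \<phi> \<delta> \<in> PB C I X A"
    unfolding Ph_def by blast
  from pre Z obtain i where "special_precover n C s I Z i"
    unfolding special_precovering_def by blast
  then obtain A A' \<delta> j Y where i: "i \<in> I" and A: "A \<in> Obj C" and A': "A' \<in> Obj C"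
    and \<delta>: "\<delta> \<in> ext_set C Z A" and j: "j \<in> perp C I" "j \<in> hom_set C A A'"
    and Y: "distinguished n C s Y (push C Z j \<delta>)"
    and Y0: "ob Y 0 = A'" and Yn1: "ob Y (n+1) = Z" and Yn: "dif Y n = i"
    unfolding special_precover_def by blast
  \<comment> \<open>The phantom property is applied to \<delta> before pushing along
    \<open>j\<close>, so that \<open>j\<close> remains available to annihilate the pullback along
    \<open>f\<close>.\<close>
  from phantom A \<delta> obtain f \<epsilon> D where D: "D \<in> Obj C" and f: "f \<in> I" "f \<in> hom_set C X D"
    and \<epsilon>: "\<epsilon> \<in> ext_set C D A" and eq: "pull C A \<phi> \<delta> = pull C A f \<epsilon>"
    unfolding PB_def by blast
  \<comment> \<open>Both sides equal \<open>Emap C \<phi> j \<delta>\<close>, by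
    bifunctoriality.\<close>
  have "pull C A' \<phi> (push C Z j \<delta>) = push C X j (pull C A \<phi> \<delta>)"
    using pull_push[OF Z X A A' \<phi> j(2) \<delta>] push_pull[OF Z X A A' \<phi> j(2) \<delta>] by simp
  also have "\<dots> = Emap C f j \<epsilon>"
    unfolding eq by (rule push_pull[OF D X A A' f(2) j(2) \<epsilon>])
  also have "\<dots> = zero_ext C X A'"
    by (rule perpD[OF additive_category_axioms j A A' X D f \<epsilon>])
  finally have zero: "pull C (ob Y 0) \<phi> (push C Z j \<delta>) = zero_ext C X (ob Y 0)"
    unfolding Y0 .
  have \<phi>': "\<phi> \<in> hom_set C X (ob Y (n+1))"
    unfolding Yn1 by (rule \<phi>)
  obtain g where g: "g \<in> hom_set C X (ob Y n)" and fac: "\<phi> = dif Y n \<cdot> g"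
    by (rule deflation_factor[OF Y X \<phi>' zero])
  have "is_complex n C Y"
    using Y unfolding distinguished_def by blast
  then have "ob Y n \<in> Obj C" "i \<in> hom_set C (ob Y n) Z"
    using Yn Yn1 unfolding is_complex_def by auto
  \<comment> \<open>\<phi> is now \<open>i\<close> precomposed with \<open>g\<close>, and
    \<open>i\<close> lies in the ideal.\<close>
  then show "\<phi> \<in> I"
    unfolding fac Yn using ideal_ofD[OF I X _ Z g] i by blast
qed

theorem proposition3p12:
  fixes n :: nat
    and C :: "('o, 'm, 'e) ext_category"
    and s :: "('o, 'm, 'e) realization"
    and I :: "'m set"
  assumes "n_exangulated_category n C s"
    and "ideal_of C I"
    and "special_precovering n C s I"
  shows "I = Ph C (PB C I)"
  using ideal_subset_Ph_PB[OF assms(2)]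
    n_exangulated_category.Ph_PB_subset_ideal[OF assms]
  by (rule subset_antisym)

end
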